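(* Let $\alpha,\beta\in(0,1)$, let $\gamma\in(\alpha/2,1)$ and $\delta\in(\beta/2,1)$, and let $\tilde\chi=(\tilde\tau,\tilde d)$ be the 3-stage test with parameters $$n_0=n^*(\gamma,\beta/2),\quad \kappa_0=\kappa^*(\gamma,\beta/2),\qquad n_1=n^*(\alpha/2,\delta),\quad \kappa_1=\kappa^*(\alpha/2,\delta),\qquad N=n^*(\alpha/2,\beta/2),\quad K=\kappa^*(\alpha/2,\beta/2).$$ Then $\tilde\chi\in\mathcal C(\alpha,\beta)$, i.e. $\mathsf P_0(\tilde d=1)\le\alpha$ and $\mathsf P_1(\tilde d=0)\le\beta$.
   Context: Setting. Let $X=(X_n)_{n\ge1}$ be a sequence of random elements of a measurable space $(\mathbb S,\mathcal S)$ and $\mathcal F_n=\sigma(X_1,\dots,X_n)$. The distribution of $X$ belongs to a family $\mathcal P$; $\mathcal P_0,\mathcal P_1\subset\mathcal P$ are disjoint, $H_i$ is the hypothesis that this distribution is in $\mathcal P_i$, and $\mathsf P_0\in\mathcal P_0$, $\mathsf P_1\in\mathcal P_1$ are fixed. A test is a pair $(\tau,d)$ where $\tau$ is a stopping time of $(\mathcal F_n)_{n\ge1}$ and $d\in\{0,1\}$ is $\mathcal F_\tau$-measurable ($d=i$ means that $H_i$ is selected). For $\alpha,\beta\in(0,1)$, $\mathcal C(\alpha,\beta)$ is the set of tests with $\mathsf P_0(d=1)\le\alpha$ and $\mathsf P_1(d=0)\le\beta$. Test statistic. $T=(T_n)_{n\ge1}$ is a sequence of real-valued statistics, $T_n$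 being $\mathcal F_n$-measurable, such that for all $\alpha,\beta\in(0,1)$ there are $n\in\mathbb N$ and $\kappa\in\mathbb R$ with $\mathsf P_0(T_n>\kappa)\le\alpha$ and $\mathsf P_1(T_n\le\kappa)\le\beta$. The smallest such $n$ is denoted $n^*(\alpha,\beta)$, and $\kappa^*(\alpha,\beta)$ denotes any $\kappa$ satisfying these two inequalities with $n=n^*(\alpha,\beta)$. 3-stage test. Its parameters are positive integers $n_0,n_1,N$ with $n_0\vee n_1<N$ and reals $\kappa_0\le\kappa_1$ and $K$. The times $n_0,n_1,N$ are visited in increasing order until a decision is made: at time $n_0$, stop and accept $H_0$ ($\tilde d=0$) if $T_{n_0}\le\kappa_0$; at time $n_1$, stop and reject $H_0$ ($\tilde d=1$) if $T_{n_1}>\kappa_1$; if no decision has been made at times $n_0,n_1$, then stop at time $N$ and reject $H_0$ if and only if $T_N>K$. (If $n_0=n_1$ both checks are made at that time.) $\tilde\tau$ is the number of observations used. *)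

theory Defs
  imports "HOL-Probability.Probability"
begin

text \<open>
  Time runs over \<^typ>\<open>enat\<close>, so that stopping times may be infinite; the sigma-algebra at a finite
  time \<open>n\<close> is generated by \<open>X 1, \<dots>, X n\<close> (trivial for \<open>n = 0\<close>), the one at \<open>\<infinity>\<close> by the whole
  sequence. Here \<open>M\<close> and \<open>S\<close> only matter as measurable spaces.
\<close>

definition obs_filtration ::
    "'w measure \<Rightarrow> 's measure \<Rightarrow> (nat \<Rightarrow> 'w \<Rightarrow> 's) \<Rightarrow> enat \<Rightarrow> 'w measure" where
  "obs_filtration M S X t =
     sigma (space M) (\<Union>i\<in>{i. 1 \<le> i \<and> enat i \<le> t}. {X i -` A \<inter> space M | A. A \<in> sets S})"

lemma filtration_obs_filtration: "filtration (space M) (obs_filtration M S X)"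
proof
  fix t :: enat
  show "space (obs_filtration M S X t) = space M"
    unfolding obs_filtration_def by (rule space_measure_of) auto
next
  fix s t :: enat
  assume "s \<le> t"
  then have sub: "(\<Union>i\<in>{i. 1 \<le> i \<and> enat i \<le> s}. {X i -` A \<inter> space M | A. A \<in> sets S})
      \<subseteq> (\<Union>i\<in>{i. 1 \<le> i \<and> enat i \<le> t}. {X i -` A \<inter> space M | A. A \<in> sets S})"
    by (intro UN_mono) (auto intro: order_trans)
  show "sets (obs_filtration M S X s) \<le> sets (obs_filtration M S X t)"
    unfolding obs_filtration_def
    by (subst (1 2) sets_measure_of; (rule sigma_sets_mono'[OF sub])?) auto
qed

text \<open>
  \<open>\<PP>\<close>, \<open>\<PP>\<^sub>0\<close>, \<open>\<PP>\<^sub>1\<close> are sets of laws of the whole sequence \<open>(X\<^sub>n)\<close>, indexed from 1. \<open>P0\<close> and \<open>P1\<close>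
  are probability measures on the underlying space under which \<open>X\<close> has a law in \<open>\<PP>\<^sub>0\<close>, resp.
  \<open>\<PP>\<^sub>1\<close>; the canonical choice is \<open>M = Pi\<^sub>M {1..} (\<lambda>_. S)\<close> with \<open>X\<close> the coordinates.
\<close>

definition seq_law :: "'s measure \<Rightarrow> (nat \<Rightarrow> 'w \<Rightarrow> 's) \<Rightarrow> 'w measure \<Rightarrow> (nat \<Rightarrow> 's) measure" where
  "seq_law S X P = distr P (Pi\<^sub>M {1..} (\<lambda>_. S)) (\<lambda>\<omega>. \<lambda>i\<in>{1..}. X i \<omega>)"

locale testing_problem =
  fixes M :: "'w measure" and S :: "'s measure" and X :: "nat \<Rightarrow> 'w \<Rightarrow> 's"
    and \<PP> \<PP>\<^sub>0 \<PP>\<^sub>1 :: "(nat \<Rightarrow> 's) measure set"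
    and P0 P1 :: "'w measure"
  assumes X_measurable: "\<And>n. 1 \<le> n \<Longrightarrow> X n \<in> M \<rightarrow>\<^sub>M S"
    and laws: "\<And>Q. Q \<in> \<PP> \<Longrightarrow> prob_space Q \<and> sets Q = sets (Pi\<^sub>M {1..} (\<lambda>_. S))"
    and hypotheses: "\<PP>\<^sub>0 \<subseteq> \<PP>" "\<PP>\<^sub>1 \<subseteq> \<PP>" "\<PP>\<^sub>0 \<inter> \<PP>\<^sub>1 = {}"
    and prob_P0: "prob_space P0" "sets P0 = sets M" "seq_law S X P0 \<in> \<PP>\<^sub>0"
    and prob_P1: "prob_space P1" "sets P1 = sets M" "seq_law S X P1 \<in> \<PP>\<^sub>1"

definition is_test ::
    "'w measure \<Rightarrow> 's measure \<Rightarrow> (nat \<Rightarrow> 'w \<Rightarrow> 's) \<Rightarrow> ('w \<Rightarrow> enat) \<times> ('w \<Rightarrow> nat) \<Rightarrow> bool" where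
  "is_test M S X = (\<lambda>(\<tau>, d).
     (\<forall>\<omega>\<in>space M. 1 \<le> \<tau> \<omega>) \<and>
     stopping_time (obs_filtration M S X) \<tau> \<and>
     d \<in> filtration.pre_sigma (space M) (obs_filtration M S X) \<tau> \<rightarrow>\<^sub>M count_space {0, 1})"

definition test_class ::
    "'w measure \<Rightarrow> 's measure \<Rightarrow> (nat \<Rightarrow> 'w \<Rightarrow> 's) \<Rightarrow> 'w measure \<Rightarrow> 'w measure \<Rightarrow> real \<Rightarrow> real
     \<Rightarrow> (('w \<Rightarrow> enat) \<times> ('w \<Rightarrow> nat)) set" where
  "test_class M S X P0 P1 \<alpha> \<beta> = {(\<tau>, d). is_test M S X (\<tau>, d) \<and>
     \<P>(\<omega> in P0. d \<omega> = 1) \<le> \<alpha> \<and> \<P>(\<omega> in P1. d \<omega> = 0) \<le> \<beta>}"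

definition fixed_size_bounds ::
    "'w measure \<Rightarrow> 'w measure \<Rightarrow> (nat \<Rightarrow> 'w \<Rightarrow> real) \<Rightarrow> real \<Rightarrow> real \<Rightarrow> nat \<Rightarrow> real \<Rightarrow> bool" where
  "fixed_size_bounds P0 P1 T \<alpha> \<beta> n \<kappa> \<longleftrightarrow>
     \<P>(\<omega> in P0. T n \<omega> > \<kappa>) \<le> \<alpha> \<and> \<P>(\<omega> in P1. T n \<omega> \<le> \<kappa>) \<le> \<beta>"

locale test_statistic = testing_problem M S X \<PP> \<PP>\<^sub>0 \<PP>\<^sub>1 P0 P1
  for M :: "'w measure" and S :: "'s measure" and X :: "nat \<Rightarrow> 'w \<Rightarrow> 's"
    and \<PP> \<PP>\<^sub>0 \<PP>\<^sub>1 :: "(nat \<Rightarrow> 's) measure set"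
    and P0 P1 :: "'w measure" +
  fixes T :: "nat \<Rightarrow> 'w \<Rightarrow> real"
  assumes T_measurable: "\<And>n. 1 \<le> n \<Longrightarrow> T n \<in> borel_measurable (obs_filtration M S X (enat n))"
    and fixed_size_exists: "\<And>\<alpha> \<beta>. \<lbrakk>0 < \<alpha>; \<alpha> < 1; 0 < \<beta>; \<beta> < 1\<rbrakk>
           \<Longrightarrow> \<exists>n\<ge>1. \<exists>\<kappa>. fixed_size_bounds P0 P1 T \<alpha> \<beta> n \<kappa>"

definition n_star ::
    "'w measure \<Rightarrow> 'w measure \<Rightarrow> (nat \<Rightarrow> 'w \<Rightarrow> real) \<Rightarrow> real \<Rightarrow> real \<Rightarrow> nat" where
  "n_star P0 P1 T \<alpha> \<beta> = (LEAST n. 1 \<le> n \<and> (\<exists>\<kappa>. fixed_size_bounds P0 P1 T \<alpha> \<beta> n \<kappa>))"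

text \<open>The threshold at \<^const>\<open>n_star\<close> need not be unique, hence a predicate.\<close>

definition is_kappa_star ::
    "'w measure \<Rightarrow> 'w measure \<Rightarrow> (nat \<Rightarrow> 'w \<Rightarrow> real) \<Rightarrow> real \<Rightarrow> real \<Rightarrow> real \<Rightarrow> bool" where
  "is_kappa_star P0 P1 T \<alpha> \<beta> \<kappa> \<longleftrightarrow> fixed_size_bounds P0 P1 T \<alpha> \<beta> (n_star P0 P1 T \<alpha> \<beta>) \<kappa>"

definition three_stage_params :: "nat \<Rightarrow> nat \<Rightarrow> nat \<Rightarrow> real \<Rightarrow> real \<Rightarrow> bool" where
  "three_stage_params n0 n1 N \<kappa>0 \<kappa>1 \<longleftrightarrow> 0 < n0 \<and> 0 < n1 \<and> max n0 n1 < N \<and> \<kappa>0 \<le> \<kappa>1"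

text \<open>
  Sample size and decision along one trajectory. If \<open>n0 = n1\<close>, the two early checks exclude each
  other because \<open>\<kappa>0 \<le> \<kappa>1\<close>, so their order is immaterial.
\<close>

definition three_stage_outcome ::
    "(nat \<Rightarrow> 'w \<Rightarrow> real) \<Rightarrow> nat \<Rightarrow> nat \<Rightarrow> nat \<Rightarrow> real \<Rightarrow> real \<Rightarrow> real \<Rightarrow> 'w \<Rightarrow> nat \<times> nat" where
  "three_stage_outcome T n0 n1 N \<kappa>0 \<kappa>1 K \<omega> =
     (let final = (N, if T N \<omega> > K then 1 else 0) in
      if n0 \<le> n1 then
        (if T n0 \<omega> \<le> \<kappa>0 then (n0, 0) else if T n1 \<omega> > \<kappa>1 then (n1, 1) else final)
      else
        (if T n1 \<omega> > \<kappa>1 then (n1, 1) else if T n0 \<omega> \<le> \<kappa>0 then (n0, 0) else final))"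

definition three_stage_test ::
    "(nat \<Rightarrow> 'w \<Rightarrow> real) \<Rightarrow> nat \<Rightarrow> nat \<Rightarrow> nat \<Rightarrow> real \<Rightarrow> real \<Rightarrow> real
     \<Rightarrow> ('w \<Rightarrow> enat) \<times> ('w \<Rightarrow> nat)" where
  "three_stage_test T n0 n1 N \<kappa>0 \<kappa>1 K =
     (\<lambda>\<omega>. enat (fst (three_stage_outcome T n0 n1 N \<kappa>0 \<kappa>1 K \<omega>)),
      \<lambda>\<omega>. snd (three_stage_outcome T n0 n1 N \<kappa>0 \<kappa>1 K \<omega>))"

end

theory Submission
  imports Defs
begin

text \<open>
  The two error bounds follow from a union bound. The \<open>3\<close>-stage test can reject the null hypothesis
  in only two ways: early, on the event that \<open>T n1\<close> exceeds \<open>\<kappa>1\<close>, or finally, on the event that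
  \<open>T N\<close> exceeds \<open>K\<close>. The thresholds at both times are calibrated at level \<open>\<alpha>/2\<close> under \<open>P0\<close>, so the
  two events together have probability at most \<open>\<alpha>\<close>. Symmetrically, acceptance can only occur when
  \<open>T n0 \<le> \<kappa>0\<close> or \<open>T N \<le> K\<close>, and each of these has probability at most \<open>\<beta>/2\<close> under \<open>P1\<close>.

  The remaining point is that the construction is a test at all. Since the sample size takes
  finite values only, it suffices to check that for every \<open>n\<close> and \<open>i\<close> the event of stopping at time
  \<open>n\<close> with decision \<open>i\<close> is determined by the first \<open>n\<close> observations
  (\<open>is_test_if_stopping_events_observable\<close>). This is the case for the \<open>3\<close>-stage test because its
  stages are visited in increasing order: stopping at time \<open>n\<close> depends on \<open>T\<close> at times up to \<open>n\<close>
  (\<open>pred_three_stage_outcome_eq\<close>).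
\<close>

lemma space_obs_filtration: "space (obs_filtration M S X t) = space M"
  by (rule filtration.space_F[OF filtration_obs_filtration])

lemma sets_obs_filtration_subset:
  assumes "\<And>n. 1 \<le> n \<Longrightarrow> X n \<in> M \<rightarrow>\<^sub>M S"
  shows "sets (obs_filtration M S X t) \<subseteq> sets M"
  unfolding obs_filtration_def
  using assms by (subst sets_measure_of) (auto intro!: sets.sigma_sets_subset measurable_sets)

text \<open>
  The event of having stopped by time \<open>t\<close> with decision \<open>i\<close> is the countable union, over the finite
  times \<open>n \<le> t\<close>, of the events of stopping exactly at \<open>n\<close> with decision \<open>i\<close>. These events are the
  ones that define measurability of the decision at the stopping time, and the union over the
  two decisions gives the stopping-time property.
\<close>

lemma is_test_if_stopping_events_observable:
  fixes \<tau> d :: "'w \<Rightarrow> nat"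
  assumes pos: "\<And>\<omega>. 1 \<le> \<tau> \<omega>" and dec: "\<And>\<omega>. d \<omega> \<in> {0, 1}"
    and obs: "\<And>n i. Measurable.pred (obs_filtration M S X (enat n)) (\<lambda>\<omega>. \<tau> \<omega> = n \<and> d \<omega> = i)"
  shows "is_test M S X (\<lambda>\<omega>. enat (\<tau> \<omega>), d)"
proof -
  let ?F = "obs_filtration M S X"
  interpret filtration "space M" ?F
    by (rule filtration_obs_filtration)
  have stopped: "Measurable.pred (?F t) (\<lambda>\<omega>. d \<omega> = i \<and> enat (\<tau> \<omega>) \<le> t)" for t i
  proof -
    have "Measurable.pred (?F t) (\<lambda>\<omega>. \<exists>n\<in>{n. enat n \<le> t}. \<tau> \<omega> = n \<and> d \<omega> = i)"
    proof (rule pred_intros_countable_bounded)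
      fix n assume "n \<in> {n. enat n \<le> t}"
      then have "sets (?F (enat n)) \<subseteq> sets (?F t)"
        by (intro sets_F_mono) simp
      then show "Measurable.pred (?F t) (\<lambda>\<omega>. \<tau> \<omega> = n \<and> d \<omega> = i)"
        using obs[of n i] by (auto simp: pred_def space_F)
    qed
    moreover have "(\<lambda>\<omega>. \<exists>n\<in>{n. enat n \<le> t}. \<tau> \<omega> = n \<and> d \<omega> = i) = (\<lambda>\<omega>. d \<omega> = i \<and> enat (\<tau> \<omega>) \<le> t)"
      by auto
    ultimately show ?thesis by simp
  qed
  have st: "stopping_time ?F (\<lambda>\<omega>. enat (\<tau> \<omega>))"
  proof
    fix t
    have "Measurable.pred (?F t)
        (\<lambda>\<omega>. (d \<omega> = 0 \<and> enat (\<tau> \<omega>) \<le> t) \<or> (d \<omega> = 1 \<and> enat (\<tau> \<omega>) \<le> t))"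
      by (intro pred_intros_logic stopped)
    moreover have "(\<lambda>\<omega>. (d \<omega> = 0 \<and> enat (\<tau> \<omega>) \<le> t) \<or> (d \<omega> = 1 \<and> enat (\<tau> \<omega>) \<le> t))
        = (\<lambda>\<omega>. enat (\<tau> \<omega>) \<le> t)"
      using dec by (auto simp: fun_eq_iff)
    ultimately show "Measurable.pred (?F t) (\<lambda>\<omega>. enat (\<tau> \<omega>) \<le> t)" by simp
  qed
  have "Measurable.pred (pre_sigma (\<lambda>\<omega>. enat (\<tau> \<omega>))) (\<lambda>\<omega>. d \<omega> = i)" for i
    by (rule pred_pre_sigmaI[OF st stopped])
  then have "{\<omega> \<in> space M. d \<omega> = i} \<in> sets (pre_sigma (\<lambda>\<omega>. enat (\<tau> \<omega>)))" for i
    by (simp add: pred_def space_pre_sigma)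
  moreover have "d -` {i} \<inter> space M = {\<omega> \<in> space M. d \<omega> = i}" for i
    by auto
  ultimately have "d \<in> pre_sigma (\<lambda>\<omega>. enat (\<tau> \<omega>)) \<rightarrow>\<^sub>M count_space {0, 1}"
    using dec by (subst measurable_count_space_eq2) (auto simp: space_pre_sigma)
  with st pos show ?thesis
    by (auto simp: is_test_def one_enat_def)
qed

text \<open>
  Stopping at \<open>n\<close> means passing every earlier check without a decision, so each value of \<open>T\<close> that
  matters carries an index at most \<open>n\<close> and is known at time \<open>n\<close>. The final stage knows both early
  values because \<open>N\<close> exceeds \<open>n0\<close> and \<open>n1\<close>.
\<close>

lemma pred_three_stage_outcome_eq:
  fixes F :: "enat \<Rightarrow> 'w measure"
  assumes filtr: "filtration \<Omega> F"
    and adapted: "\<And>n. 1 \<le> n \<Longrightarrow> T n \<in> borel_measurable (F (enat n))"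
    and params: "three_stage_params n0 n1 N \<kappa>0 \<kappa>1"
  shows "Measurable.pred (F (enat n)) (\<lambda>\<omega>. three_stage_outcome T n0 n1 N \<kappa>0 \<kappa>1 K \<omega> = (n, i))"
proof -
  interpret filtration \<Omega> F by fact
  have order: "0 < n0" "0 < n1" "n0 < N" "n1 < N"
    using params by (auto simp: three_stage_params_def)
  \<comment> \<open>The guard \<open>m \<le> n\<close> makes the event observable at time \<open>n\<close> for every \<open>m\<close>.\<close>
  have above: "Measurable.pred (F (enat n)) (\<lambda>\<omega>. m \<le> n \<and> \<kappa> < T m \<omega>)" if "0 < m" for m \<kappa>
  proof (cases "m \<le> n")
    case True
    have "T m \<in> borel_measurable (F (enat m))"
      using that by (intro adapted) simp
    moreover have "sets (F (enat m)) \<subseteq> sets (F (enat n))"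
      using True by (intro sets_F_mono) simp
    ultimately have [measurable]: "T m \<in> borel_measurable (F (enat n))"
      by (auto simp: measurable_def space_F)
    show ?thesis by measurable
  qed simp
  define E0 where "E0 = (\<lambda>\<omega>. n0 \<le> n \<and> \<kappa>0 < T n0 \<omega>)"
  define E1 where "E1 = (\<lambda>\<omega>. n1 \<le> n \<and> \<kappa>1 < T n1 \<omega>)"
  define EN where "EN = (\<lambda>\<omega>. N \<le> n \<and> K < T N \<omega>)"
  have [measurable]: "Measurable.pred (F (enat n)) E0" "Measurable.pred (F (enat n)) E1"
    "Measurable.pred (F (enat n)) EN"
    unfolding E0_def E1_def EN_def by (rule above; use order in linarith)+
  have "three_stage_outcome T n0 n1 N \<kappa>0 \<kappa>1 K \<omega> = (n, i) \<longleftrightarrow>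
      (n = n0 \<and> i = 0 \<and> \<not> E0 \<omega> \<and> \<not> (n1 < n0 \<and> E1 \<omega>)) \<or>
      (n = n1 \<and> i = 1 \<and> E1 \<omega> \<and> \<not> (n0 \<le> n1 \<and> \<not> E0 \<omega>)) \<or>
      (n = N \<and> E0 \<omega> \<and> \<not> E1 \<omega> \<and> (EN \<omega> \<and> i = 1 \<or> \<not> EN \<omega> \<and> i = 0))" for \<omega>
    using order unfolding three_stage_outcome_def Let_def E0_def E1_def EN_def
    by (cases "n0 \<le> n1"; cases "T n0 \<omega> \<le> \<kappa>0"; cases "\<kappa>1 < T n1 \<omega>"; cases "K < T N \<omega>")
      (simp_all; fastforce)+
  then show ?thesis by (simp only:) measurable
qed

lemma three_stage_decision_eq_1D:
  "snd (three_stage_outcome T n0 n1 N \<kappa>0 \<kappa>1 K \<omega>) = 1 \<Longrightarrow> \<kappa>1 < T n1 \<omega> \<or> K < T N \<omega>"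
  by (auto simp: three_stage_outcome_def Let_def split: if_splits)

lemma three_stage_decision_eq_0D:
  "snd (three_stage_outcome T n0 n1 N \<kappa>0 \<kappa>1 K \<omega>) = 0 \<Longrightarrow> T n0 \<omega> \<le> \<kappa>0 \<or> T N \<omega> \<le> K"
  by (auto simp: three_stage_outcome_def Let_def split: if_splits)

lemma (in prob_space) prob_le_if_implies_disj:
  assumes "\<And>\<omega>. R \<omega> \<Longrightarrow> A \<omega> \<or> B \<omega>"
    and [measurable]: "Measurable.pred M A" "Measurable.pred M B"
    and "\<P>(\<omega> in M. A \<omega>) \<le> a" "\<P>(\<omega> in M. B \<omega>) \<le> b"
  shows "\<P>(\<omega> in M. R \<omega>) \<le> a + b"
proof -
  have "\<P>(\<omega> in M. R \<omega>) \<le> prob ({\<omega> \<in> space M. A \<omega>} \<union> {\<omega> \<in> space M. B \<omega>})"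
    using assms(1) by (intro finite_measure_mono) auto
  also have "\<dots> \<le> \<P>(\<omega> in M. A \<omega>) + \<P>(\<omega> in M. B \<omega>)"
    by (intro measure_Un_le) auto
  finally show ?thesis using assms(4,5) by linarith
qed

theorem theorem3p1:
  fixes M :: "'w measure" and S :: "'s measure" and X :: "nat \<Rightarrow> 'w \<Rightarrow> 's"
    and \<PP> \<PP>\<^sub>0 \<PP>\<^sub>1 :: "(nat \<Rightarrow> 's) measure set"
    and P0 P1 :: "'w measure"
    and T :: "nat \<Rightarrow> 'w \<Rightarrow> real"
    and \<alpha> \<beta> \<gamma> \<delta> :: real
    and n0 n1 N :: nat and \<kappa>0 \<kappa>1 K :: real
  assumes "test_statistic M S X \<PP> \<PP>\<^sub>0 \<PP>\<^sub>1 P0 P1 T"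
    and "\<alpha> \<in> {0<..<1}" and "\<beta> \<in> {0<..<1}"
    and "\<gamma> \<in> {\<alpha>/2<..<1}" and "\<delta> \<in> {\<beta>/2<..<1}"
    and "n0 = n_star P0 P1 T \<gamma> (\<beta>/2)" and "is_kappa_star P0 P1 T \<gamma> (\<beta>/2) \<kappa>0"
    and "n1 = n_star P0 P1 T (\<alpha>/2) \<delta>" and "is_kappa_star P0 P1 T (\<alpha>/2) \<delta> \<kappa>1"
    and "N = n_star P0 P1 T (\<alpha>/2) (\<beta>/2)" and "is_kappa_star P0 P1 T (\<alpha>/2) (\<beta>/2) K"
    and "three_stage_params n0 n1 N \<kappa>0 \<kappa>1"
  shows "three_stage_test T n0 n1 N \<kappa>0 \<kappa>1 K \<in> test_class M S X P0 P1 \<alpha> \<beta>"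
proof -
  interpret test_statistic M S X \<PP> \<PP>\<^sub>0 \<PP>\<^sub>1 P0 P1 T by fact
  interpret P0: prob_space P0 by (rule prob_P0)
  interpret P1: prob_space P1 by (rule prob_P1)
  let ?out = "three_stage_outcome T n0 n1 N \<kappa>0 \<kappa>1 K"
  have pos: "1 \<le> n0" "1 \<le> n1" "1 \<le> N"
    using assms(12) by (auto simp: three_stage_params_def)
  have "is_test M S X (\<lambda>\<omega>. enat (fst (?out \<omega>)), \<lambda>\<omega>. snd (?out \<omega>))"
  proof (rule is_test_if_stopping_events_observable)
    show "1 \<le> fst (?out \<omega>)" for \<omega>
      using pos by (simp add: three_stage_outcome_def Let_def)
    show "snd (?out \<omega>) \<in> {0, 1}" for \<omega>
      by (simp add: three_stage_outcome_def Let_def)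
    show "Measurable.pred (obs_filtration M S X (enat n)) (\<lambda>\<omega>. fst (?out \<omega>) = n \<and> snd (?out \<omega>) = i)"
      for n i
      using pred_three_stage_outcome_eq[OF filtration_obs_filtration T_measurable assms(12)]
      by (simp add: prod_eq_iff)
  qed
  moreover have T_M: "T n \<in> borel_measurable M" if "1 \<le> n" for n
    using T_measurable[OF that] sets_obs_filtration_subset[of X M S "enat n"] X_measurable
    by (auto simp: measurable_def space_obs_filtration)
  have T_P: "T n \<in> borel_measurable P0" "T n \<in> borel_measurable P1" if "1 \<le> n" for n
    using T_M[OF that] measurable_cong_sets[OF prob_P0(2) refl, of borel]
      measurable_cong_sets[OF prob_P1(2) refl, of borel] by auto
  note [measurable] = T_P[OF pos(1)] T_P[OF pos(2)] T_P[OF pos(3)]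
  have bounds: "\<P>(\<omega> in P0. \<kappa>1 < T n1 \<omega>) \<le> \<alpha>/2" "\<P>(\<omega> in P0. K < T N \<omega>) \<le> \<alpha>/2"
    "\<P>(\<omega> in P1. T n0 \<omega> \<le> \<kappa>0) \<le> \<beta>/2" "\<P>(\<omega> in P1. T N \<omega> \<le> K) \<le> \<beta>/2"
    using assms(6-11) by (simp_all add: is_kappa_star_def fixed_size_bounds_def)
  have "\<P>(\<omega> in P0. snd (?out \<omega>) = 1) \<le> \<alpha>/2 + \<alpha>/2"
    by (rule P0.prob_le_if_implies_disj[OF _ _ _ bounds(1,2)]) (auto dest!: three_stage_decision_eq_1D[unfolded One_nat_def])
  moreover have "\<P>(\<omega> in P1. snd (?out \<omega>) = 0) \<le> \<beta>/2 + \<beta>/2"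
    by (rule P1.prob_le_if_implies_disj[OF _ _ _ bounds(3,4)]) (auto dest!: three_stage_decision_eq_0D[unfolded One_nat_def])
  ultimately show ?thesis
    by (simp add: three_stage_test_def test_class_def)
qed

end
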